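(* Let $A^\ast_{n,\le m}$, $A^\ast_{n,\ge m}$, $\xi_n$, $\alpha_j$ be taken from any one of the four families (Bernoulli, Cauchy, Euler, Euler of the second kind) described in the context, with the corresponding integer parameter $N$, and let $m\ge1$. For $n\ge1$: if $n\le m$, then $$\alpha_n=\sum_{t_1+2t_2+\cdots+mt_m=n}\binom{t_1+\cdots+t_m}{t_1,\dots,t_m}(-1)^{n-t_1-\cdots-t_m}\left(\frac{A_{1,\le m}^\ast}{\xi_1}\right)^{t_1}\left(\frac{A_{2,\le m}^\ast}{\xi_2}\right)^{t_2}\cdots\left(\frac{A_{m,\le m}^\ast}{\xi_m}\right)^{t_m},$$ and if $n\ge m$, then $$\alpha_n=\sum_{mt_m+(m+1)t_{m+1}+\cdots+nt_n=n}\binom{t_m+t_{m+1}+\cdots+t_n}{t_m,t_{m+1},\dots,t_n}(-1)^{n-t_m-t_{m+1}-\cdots-t_n}\left(\frac{A_{m,\ge m}^\ast}{\xi_m}\right)^{t_m}\left(\frac{A_{m+1,\ge m}^\ast}{\xi_{m+1}}\right)^{t_{m+1}}\cdots\left(\frac{A_{n,\ge m}^\ast}{\xi_n}\right)^{t_n},$$ where the sums run over tuples of nonnegative integers $(t_1,\dots,t_m)$, respectively $(t_m,\dots,t_n)$.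
   Context: $(x)^{(n)}=x(x+1)\cdots(x+n-1)$ for $n\ge1$ and $(x)^{(0)}=1$ (rising factorial). $\binom{t_1+\cdots+t_r}{t_1,\dots,t_r}=\frac{(t_1+\cdots+t_r)!}{t_1!\cdots t_r!}$, and $0^0=1$. All identities below are between formal power series in $x$. For an integer $m\ge 1$ define the modified restricted and modified associated hypergeometric numbers by: - Bernoulli ($N\ge1$): $\left(\sum_{n=0}^{m}\frac{x^n}{(N+1)^{(n)}}\right)^{-1}=\sum_{n=0}^\infty B_{N,n,\le m}^\ast\frac{x^n}{n!}$ and $\left(1+\sum_{n=m}^{\infty}\frac{x^n}{(N+1)^{(n)}}\right)^{-1}=\sum_{n=0}^\infty B_{N,n,\ge m}^\ast\frac{x^n}{n!}$; - Cauchy ($N\ge1$): $\left(N\sum_{n=0}^{m}\frac{(-x)^n}{N+n}\right)^{-1}=\sum_{n=0}^\infty c_{N,n,\le m}^\ast\frac{x^n}{n!}$ and $\left(1+N\sum_{n=m}^{\infty}\frac{(-x)^n}{N+n}\right)^{-1}=\sum_{n=0}^\infty c_{N,n,\ge m}^\ast\frac{x^n}{n!}$; - Euler ($N\ge0$): $\left(\sum_{n=0}^{m}\frac{x^{2n}}{(2N+1)^{(2n)}}\right)^{-1}=\sum_{n=0}^\infty E_{N,n,\le m}^\ast\frac{x^n}{n!}$ and $\left(1+\sum_{n=m}^{\infty}\frac{x^{2n}}{(2N+1)^{(2n)}}\right)^{-1}=\sum_{n=0}^\infty E_{N,n,\ge m}^\ast\frac{x^n}{n!}$; - Euler of the second kind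 ($N\ge0$): $\left(\sum_{n=0}^{m}\frac{x^{2n}}{(2N+2)^{(2n)}}\right)^{-1}=\sum_{n=0}^\infty\widehat E_{N,n,\le m}^\ast\frac{x^n}{n!}$ and $\left(1+\sum_{n=m}^{\infty}\frac{x^{2n}}{(2N+2)^{(2n)}}\right)^{-1}=\sum_{n=0}^\infty\widehat E_{N,n,\ge m}^\ast\frac{x^n}{n!}$. The symbols $A^\ast_{n,\le m}$, $A^\ast_{n,\ge m}$, $\xi_n$ ($n\ge0$), $\alpha_j$ ($j\ge1$) denote simultaneously one of the following choices ($N$ is suppressed from the notation): - Bernoulli: $A^\ast_{n,\le m}=B^\ast_{N,n,\le m}$, $A^\ast_{n,\ge m}=B^\ast_{N,n,\ge m}$, $\xi_n=(-1)^n n!$, $\alpha_j=\frac{N!}{(N+j)!}$, $N\ge1$; - Cauchy: $A^\ast_{n,\le m}=c^\ast_{N,n,\le m}$, $A^\ast_{n,\ge m}=c^\ast_{N,n,\ge m}$, $\xi_n=n!$, $\alpha_j=\frac{N}{N+j}$, $N\ge1$; - Euler: $A^\ast_{n,\le m}=E^\ast_{N,2n,\le m}$, $A^\ast_{n,\ge m}=E^\ast_{N,2n,\ge m}$, $\xi_n=(-1)^n(2n)!$, $\alpha_j=\frac{(2N)!}{(2N+2j)!}$, $N\ge0$; - Euler of the second kind: $A^\ast_{n,\le m}=\widehat E^\ast_{N,2n,\le m}$, $A^\ast_{n,\ge m}=\widehat E^\ast_{N,2n,\ge m}$, $\xi_n=(-1)^n(2n)!$, $\alpha_j=\frac{(2N+1)!}{(2N+2j+1)!}$,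 $N\ge0$. *)

theory Defs
  imports "HOL-Computational_Algebra.Computational_Algebra" "HOL-Library.FuncSet"
begin

definition egf_coeff :: "rat fps \<Rightarrow> nat \<Rightarrow> rat" where
  "egf_coeff F n = fact n * fps_nth F n"

lemma egf_coeff_expansion: "Abs_fps (\<lambda>n. egf_coeff F n / fact n) = F"
  by (simp add: fps_eq_iff egf_coeff_def)

text \<open>
  In all eight definitions the parameters are \<open>N\<close>, \<open>m\<close> and the index \<open>n\<close>, in this order. The finite
  sums are sums of formal power series; an infinite tail starting at \<open>x^m\<close> (or at \<open>x^(2m)\<close>) is given
  by its coefficient function. In the Euler cases the summand with \<open>x^(2i)\<close> is the
  coefficient at the even index \<open>k = 2i\<close>, and odd coefficients vanish.
\<close>

definition bernoulli_le :: "nat \<Rightarrow> nat \<Rightarrow> nat \<Rightarrow> rat" where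
  "bernoulli_le N m = egf_coeff (inverse
     (\<Sum>i=0..m. fps_const (1 / pochhammer (of_nat N + 1) i) * fps_X ^ i))"

definition bernoulli_ge :: "nat \<Rightarrow> nat \<Rightarrow> nat \<Rightarrow> rat" where
  "bernoulli_ge N m = egf_coeff (inverse
     (1 + Abs_fps (\<lambda>k. if m \<le> k then 1 / pochhammer (of_nat N + 1) k else 0)))"

definition cauchy_le :: "nat \<Rightarrow> nat \<Rightarrow> nat \<Rightarrow> rat" where
  "cauchy_le N m = egf_coeff (inverse
     (of_nat N * (\<Sum>i=0..m. fps_const (1 / (of_nat N + of_nat i)) * (- fps_X) ^ i)))"

definition cauchy_ge :: "nat \<Rightarrow> nat \<Rightarrow> nat \<Rightarrow> rat" where
  "cauchy_ge N m = egf_coeff (inverse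
     (1 + of_nat N * Abs_fps (\<lambda>k. if m \<le> k then (-1) ^ k / (of_nat N + of_nat k) else 0)))"

definition euler_le :: "nat \<Rightarrow> nat \<Rightarrow> nat \<Rightarrow> rat" where
  "euler_le N m = egf_coeff (inverse
     (\<Sum>i=0..m. fps_const (1 / pochhammer (2 * of_nat N + 1) (2 * i)) * fps_X ^ (2 * i)))"

definition euler_ge :: "nat \<Rightarrow> nat \<Rightarrow> nat \<Rightarrow> rat" where
  "euler_ge N m = egf_coeff (inverse
     (1 + Abs_fps (\<lambda>k. if even k \<and> 2 * m \<le> k
                        then 1 / pochhammer (2 * of_nat N + 1) k else 0)))"

definition euler2_le :: "nat \<Rightarrow> nat \<Rightarrow> nat \<Rightarrow> rat" where
  "euler2_le N m = egf_coeff (inverse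
     (\<Sum>i=0..m. fps_const (1 / pochhammer (2 * of_nat N + 2) (2 * i)) * fps_X ^ (2 * i)))"

definition euler2_ge :: "nat \<Rightarrow> nat \<Rightarrow> nat \<Rightarrow> rat" where
  "euler2_ge N m = egf_coeff (inverse
     (1 + Abs_fps (\<lambda>k. if even k \<and> 2 * m \<le> k
                        then 1 / pochhammer (2 * of_nat N + 2) k else 0)))"

datatype family = Bernoulli | Cauchy | Euler | Euler2

fun admissible :: "family \<Rightarrow> nat \<Rightarrow> bool" where
  "admissible Bernoulli N \<longleftrightarrow> N \<ge> 1"
| "admissible Cauchy N \<longleftrightarrow> N \<ge> 1"
| "admissible Euler N \<longleftrightarrow> N \<ge> 0"
| "admissible Euler2 N \<longleftrightarrow> N \<ge> 0"

fun A_le :: "family \<Rightarrow> nat \<Rightarrow> nat \<Rightarrow> nat \<Rightarrow> rat" where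
  "A_le Bernoulli N m n = bernoulli_le N m n"
| "A_le Cauchy N m n = cauchy_le N m n"
| "A_le Euler N m n = euler_le N m (2 * n)"
| "A_le Euler2 N m n = euler2_le N m (2 * n)"

fun A_ge :: "family \<Rightarrow> nat \<Rightarrow> nat \<Rightarrow> nat \<Rightarrow> rat" where
  "A_ge Bernoulli N m n = bernoulli_ge N m n"
| "A_ge Cauchy N m n = cauchy_ge N m n"
| "A_ge Euler N m n = euler_ge N m (2 * n)"
| "A_ge Euler2 N m n = euler2_ge N m (2 * n)"

fun xi :: "family \<Rightarrow> nat \<Rightarrow> rat" where
  "xi Bernoulli n = (-1) ^ n * fact n"
| "xi Cauchy n = fact n"
| "xi Euler n = (-1) ^ n * fact (2 * n)"
| "xi Euler2 n = (-1) ^ n * fact (2 * n)"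

fun alpha :: "family \<Rightarrow> nat \<Rightarrow> nat \<Rightarrow> rat" where
  "alpha Bernoulli N j = fact N / fact (N + j)"
| "alpha Cauchy N j = of_nat N / (of_nat N + of_nat j)"
| "alpha Euler N j = fact (2 * N) / fact (2 * N + 2 * j)"
| "alpha Euler2 N j = fact (2 * N + 1) / fact (2 * N + 2 * j + 1)"

definition multinomial :: "nat set \<Rightarrow> (nat \<Rightarrow> nat) \<Rightarrow> rat" where
  "multinomial I t = fact (\<Sum>i\<in>I. t i) / (\<Prod>i\<in>I. fact (t i))"

text \<open>
  Tuples \<open>(t_a, ..., t_b)\<close> of natural numbers with \<open>a t_a + ... + b t_b = n\<close>; being extensional
  functions on \<open>{a..b}\<close>, distinct functions are distinct tuples. For \<open>a \<ge> 1\<close> there are finitely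
  many of them, and \<open>t_a + ... + t_b \<le> n\<close>, so that \<open>n - (t_a + ... + t_b)\<close> does not truncate.
\<close>

definition weighted_tuples :: "nat \<Rightarrow> nat \<Rightarrow> nat \<Rightarrow> (nat \<Rightarrow> nat) set" where
  "weighted_tuples a b n = {t \<in> {a..b} \<rightarrow>\<^sub>E UNIV. (\<Sum>i=a..b. i * t i) = n}"

lemma weighted_tuples_sum_le:
  assumes "a \<ge> 1" "t \<in> weighted_tuples a b n"
  shows "(\<Sum>i=a..b. t i) \<le> n"
proof -
  have "(\<Sum>i=a..b. t i) \<le> (\<Sum>i=a..b. i * t i)"
    using assms(1) by (intro sum_mono) auto
  then show ?thesis using assms(2) by (simp add: weighted_tuples_def)
qed

lemma finite_weighted_tuples:
  assumes "a \<ge> 1"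
  shows "finite (weighted_tuples a b n)"
proof (rule finite_subset)
  show "weighted_tuples a b n \<subseteq> {a..b} \<rightarrow>\<^sub>E {0..n}"
  proof
    fix t assume t: "t \<in> weighted_tuples a b n"
    have "t i \<le> n" if "i \<in> {a..b}" for i
    proof -
      have "t i \<le> (\<Sum>i=a..b. t i)"
        using that by (intro member_le_sum) auto
      then show ?thesis using weighted_tuples_sum_le[OF assms t] by linarith
    qed
    then show "t \<in> {a..b} \<rightarrow>\<^sub>E {0..n}"
      using t by (auto simp: weighted_tuples_def PiE_iff)
  qed
  show "finite ({a..b} \<rightarrow>\<^sub>E {0..n})"
    by (intro finite_PiE) auto
qed

end

theory Submission
  imports Defs
begin

text \<open>
  All eight identities are one identity for power series. Let \<open>H\<close> be the series with coefficients
  \<open>(-1)^i \<alpha>\<^sub>i\<close>, truncated as prescribed: to the degrees \<open>i \<le> m\<close>, or to the degrees \<open>i = 0\<close> and \<open>i \<ge> m\<close>.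
  The series inverted in the definition of a family is \<open>H\<close> composed with a monomial: with \<open>-x\<close> for
  Bernoulli, \<open>x\<close> for Cauchy and \<open>-x\<^sup>2\<close> for the two Euler families. Composition commutes with
  inversion, and the normalisation by \<open>\<xi>\<close> undoes both the factorials and this substitution, so in
  every family \<open>A\<^sub>i / \<xi>\<^sub>i\<close> is the coefficient of \<open>x^i\<close> in \<open>R = 1 / H\<close>.

  The claim is then Trudi's formula for the coefficients of \<open>H = 1 / R\<close>: expanding the geometric
  series \<open>\<Sum>\<^sub>k (1 - R)^k\<close> by the multinomial theorem gives a sum over tuples with sign
  \<open>(-1)^(t\<^sub>1 + t\<^sub>2 + \<dots>)\<close>, and the remaining factor \<open>(-1)^n\<close> is the sign of \<open>\<alpha>\<^sub>n\<close> in \<open>H\<close>. Only the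
  coefficients of \<open>R\<close> in degrees \<open>1\<close> to \<open>n\<close> enter. If \<open>n \<le> m\<close>, these are indexed by part of
  \<open>{1..m}\<close>, and the tuple entries beyond \<open>n\<close> are forced to vanish; in the second case \<open>H\<close>, hence
  also \<open>R\<close>, has no terms in degrees strictly between \<open>0\<close> and \<open>m\<close>.

  Trudi's formula is proved here without expanding powers. A tuple is viewed as a partition of \<open>n\<close>
  with \<open>t\<^sub>i\<close> parts of size \<open>i\<close>. Removing one part, in all possible sizes, splits the multinomial
  coefficient as in Pascal's rule (\<open>tuple_weight_pascal\<close>), so the sums over tuples satisfy
  the same recurrence as the coefficients of \<open>1 / R\<close> (\<open>fps_inverse_nth_trudi\<close>).
\<close>

section \<open>Sums over weighted tuples\<close>

definition tuple_weight :: "nat set \<Rightarrow> (nat \<Rightarrow> rat) \<Rightarrow> (nat \<Rightarrow> nat) \<Rightarrow> rat" where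
  "tuple_weight I c t = multinomial I t * (\<Prod>i\<in>I. c i ^ t i)"

lemma tuple_weight_remove_part:
  assumes "finite I" "i \<in> I" "t i > 0"
  shows "c i * tuple_weight I c (t(i := t i - 1)) =
    of_nat (t i) / of_nat (\<Sum>j\<in>I. t j) * tuple_weight I c t"
proof -
  obtain k where k: "t i = Suc k" using assms(3) by (cases "t i") auto
  define s where "s = (\<Sum>j\<in>I - {i}. t j)"
  have sum: "(\<Sum>j\<in>I. t j) = Suc (k + s)"
    using assms k by (simp add: sum.remove[of I i] s_def)
  have sum': "(\<Sum>j\<in>I. (t(i := k)) j) = k + s"
    using assms k by (simp add: sum.remove[of I i] s_def)
  have rest: "(\<Prod>j\<in>I - {i}. g j ((t(i := k)) j)) = (\<Prod>j\<in>I - {i}. g j (t j))"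
    for g :: "nat \<Rightarrow> nat \<Rightarrow> rat"
    by (intro prod.cong) auto
  define p q where "p = (\<Prod>j\<in>I - {i}. fact (t j) :: rat)" and "q = (\<Prod>j\<in>I - {i}. c j ^ t j)"
  have "p \<noteq> 0" unfolding p_def using assms by simp
  have weight: "tuple_weight I c t = fact (Suc (k + s)) / (fact (Suc k) * p) * (c i ^ Suc k * q)"
    unfolding tuple_weight_def multinomial_def sum using assms k
    by (simp add: prod.remove[of I i] p_def q_def)
  have weight': "tuple_weight I c (t(i := k)) = fact (k + s) / (fact k * p) * (c i ^ k * q)"
    unfolding tuple_weight_def multinomial_def sum'
    using assms k rest[of "\<lambda>_. fact"] rest[of "\<lambda>j. power (c j)"]
    by (simp add: prod.remove[of I i] p_def q_def)
  have "t(i := t i - 1) = t(i := k)" using k by simp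
  then show ?thesis
    unfolding sum weight k using \<open>p \<noteq> 0\<close>
    by (simp only: weight' fact_Suc) (simp del: of_nat_Suc add: field_simps)
qed

text \<open>
  Removing a part of size \<open>i\<close> accounts for the fraction \<open>t\<^sub>i / \<Sum>\<^sub>j t\<^sub>j\<close> of the weight, and these
  fractions add up to one.
\<close>

lemma tuple_weight_pascal:
  assumes "finite I" "(\<Sum>j\<in>I. t j) > 0"
  shows "tuple_weight I c t =
    (\<Sum>i\<in>I. if t i > 0 then c i * tuple_weight I c (t(i := t i - 1)) else 0)"
proof -
  have share: "(if t i > 0 then c i * tuple_weight I c (t(i := t i - 1)) else 0) =
      of_nat (t i) / of_nat (\<Sum>j\<in>I. t j) * tuple_weight I c t" if "i \<in> I" for i
    using tuple_weight_remove_part[OF assms(1) that, of t c]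
    by (cases "t i > 0") (simp_all del: of_nat_sum)
  have "(\<Sum>i\<in>I. if t i > 0 then c i * tuple_weight I c (t(i := t i - 1)) else 0) =
    (\<Sum>i\<in>I. of_nat (t i) / of_nat (\<Sum>j\<in>I. t j) * tuple_weight I c t)"
    by (intro sum.cong refl share)
  also have "\<dots> = of_nat (\<Sum>i\<in>I. t i) / of_nat (\<Sum>j\<in>I. t j) * tuple_weight I c t"
    by (simp only: of_nat_sum sum_divide_distrib[symmetric] sum_distrib_right[symmetric])
  also have "\<dots> = tuple_weight I c t"
    using assms(2) by (simp del: of_nat_sum)
  finally show ?thesis by simp
qed

lemma weighted_sum_update:
  fixes t :: "nat \<Rightarrow> nat"
  assumes "i \<in> {a..b}"
  shows "(\<Sum>j=a..b. j * (t(i := k)) j) + i * t i = (\<Sum>j=a..b. j * t j) + i * k"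
proof -
  have "(\<Sum>j\<in>{a..b} - {i}. j * (t(i := k)) j) = (\<Sum>j\<in>{a..b} - {i}. j * t j)"
    by (intro sum.cong) auto
  then show ?thesis
    using assms by (simp add: sum.remove[of "{a..b}" i])
qed

lemma sum_over_tuples_with_part:
  assumes i: "i \<in> {a..b}" "i \<le> n"
  shows "(\<Sum>t\<in>{t \<in> weighted_tuples a b n. t i > 0}. g (t(i := t i - 1))) =
    (\<Sum>t\<in>weighted_tuples a b (n - i). g t)"
proof (rule sum.reindex_bij_witness[where i = "\<lambda>t. t(i := Suc (t i))" and
      j = "\<lambda>t. t(i := t i - 1)"])
  fix t assume t: "t \<in> {t \<in> weighted_tuples a b n. t i > 0}"
  then show "(t(i := t i - 1))(i := Suc ((t(i := t i - 1)) i)) = t" by auto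
  obtain k where k: "t i = Suc k" using t by (cases "t i") auto
  show "t(i := t i - 1) \<in> weighted_tuples a b (n - i)"
    using t i k weighted_sum_update[OF i(1), of t k]
    by (auto simp: weighted_tuples_def PiE_iff extensional_def)
next
  fix t assume t: "t \<in> weighted_tuples a b (n - i)"
  then show "(t(i := Suc (t i)))(i := (t(i := Suc (t i))) i - 1) = t" by auto
  show "t(i := Suc (t i)) \<in> {t \<in> weighted_tuples a b n. t i > 0}"
    using t i weighted_sum_update[OF i(1), of t "Suc (t i)"]
    by (auto simp: weighted_tuples_def PiE_iff extensional_def)
qed auto

text \<open>The recurrence of the coefficients of \<open>1 / (1 - \<Sum>\<^sub>i c\<^sub>i x^i)\<close>, with \<open>i\<close> from \<open>a\<close> to \<open>b\<close>.\<close>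

lemma tuple_sum_recurrence:
  assumes a: "a \<ge> 1" and n: "n \<ge> 1"
  shows "(\<Sum>t\<in>weighted_tuples a b n. tuple_weight {a..b} c t) =
    (\<Sum>i\<in>{a..b} \<inter> {..n}. c i * (\<Sum>t\<in>weighted_tuples a b (n - i). tuple_weight {a..b} c t))"
proof -
  let ?w = "tuple_weight {a..b} c" and ?W = "weighted_tuples a b"
  note fin = finite_weighted_tuples[OF a]
  have pos: "(\<Sum>j=a..b. t j) > 0" if "t \<in> ?W n" for t
  proof (rule ccontr)
    assume "\<not> ?thesis"
    then have "(\<Sum>j=a..b. j * t j) = 0" by simp
    moreover have "(\<Sum>j=a..b. j * t j) = n" using that by (simp add: weighted_tuples_def)
    ultimately show False using n by linarith
  qed
  have large: "i \<le> n" if "t \<in> ?W n" "i \<in> {a..b}" "t i > 0" for i t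
  proof -
    have "i * t i \<le> (\<Sum>j=a..b. j * t j)"
      using that(2) by (intro member_le_sum) auto
    moreover have "i \<le> i * t i" using that(3) by simp
    moreover have "(\<Sum>j=a..b. j * t j) = n" using that(1) by (simp add: weighted_tuples_def)
    ultimately show ?thesis by linarith
  qed
  have "(\<Sum>t\<in>?W n. ?w t) =
    (\<Sum>t\<in>?W n. \<Sum>i=a..b. if t i > 0 then c i * ?w (t(i := t i - 1)) else 0)"
    using pos by (intro sum.cong tuple_weight_pascal) auto
  also have "\<dots> = (\<Sum>i=a..b. \<Sum>t\<in>?W n. if t i > 0 then c i * ?w (t(i := t i - 1)) else 0)"
    by (rule sum.swap)
  also have "\<dots> = (\<Sum>i=a..b. \<Sum>t\<in>{t \<in> ?W n. t i > 0}. c i * ?w (t(i := t i - 1)))"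
    by (intro sum.cong refl sum.inter_filter[symmetric] fin)
  also have "\<dots> = (\<Sum>i\<in>{a..b} \<inter> {..n}. \<Sum>t\<in>{t \<in> ?W n. t i > 0}. c i * ?w (t(i := t i - 1)))"
    using large by (intro sum.mono_neutral_right) (auto intro!: sum.neutral)
  also have "\<dots> = (\<Sum>i\<in>{a..b} \<inter> {..n}. c i * (\<Sum>t\<in>?W (n - i). ?w t))"
    using sum_over_tuples_with_part[of _ a b n ?w]
    by (intro sum.cong) (auto simp: sum_distrib_left[symmetric])
  finally show ?thesis .
qed

lemma weighted_tuples_0:
  assumes "a \<ge> 1"
  shows "weighted_tuples a b 0 = {\<lambda>i\<in>{a..b}. 0}"
  using assms by (fastforce simp: weighted_tuples_def PiE_iff extensional_def)

section \<open>Coefficients of an inverse power series\<close>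

lemma fps_inverse_nth_recurrence:
  fixes R :: "'a :: field fps"
  assumes "fps_nth R 0 = 1" "n \<ge> 1"
  shows "fps_nth (inverse R) n = (\<Sum>i=1..n. - fps_nth R i * fps_nth (inverse R) (n - i))"
proof -
  have "R * inverse R = 1"
    using assms(1) by (simp add: inverse_mult_eq_1')
  then have "(\<Sum>i=0..n. fps_nth R i * fps_nth (inverse R) (n - i)) = 0"
    using assms(2) by (metis fps_mult_nth fps_one_nth not_one_le_zero)
  then show ?thesis
    using assms by (simp add: sum.atLeast_Suc_atMost[of 0] sum_negf add_eq_0_iff2)
qed

text \<open>
  The recurrence for the coefficients of \<open>1 / R\<close> has one term for each degree from \<open>1\<close> to \<open>n\<close>,
  that for tuples one term for each part of size at most \<open>n\<close>. They agree because \<open>R\<close> vanishes in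
  the degrees that are not allowed as parts; this is required only up to \<open>n\<close>, so that parts may
  be bounded by any \<open>b \<ge> n\<close> even if \<open>R\<close> has infinitely many terms.
\<close>

lemma fps_inverse_nth_trudi:
  fixes R :: "rat fps"
  assumes a: "a \<ge> 1" and R0: "fps_nth R 0 = 1"
    and "\<And>i. 1 \<le> i \<Longrightarrow> i \<le> n \<Longrightarrow> i \<notin> {a..b} \<Longrightarrow> fps_nth R i = 0"
  shows "fps_nth (inverse R) n =
    (\<Sum>t\<in>weighted_tuples a b n. tuple_weight {a..b} (\<lambda>i. - fps_nth R i) t)"
  using assms(3)
proof (induction n rule: less_induct)
  case (less n)
  let ?c = "\<lambda>i. - fps_nth R i"
  show ?case
  proof (cases "n = 0")
    case True
    then show ?thesis
      using R0 a by (simp add: weighted_tuples_0 tuple_weight_def multinomial_def)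
  next
    case False
    then have "fps_nth (inverse R) n = (\<Sum>i=1..n. ?c i * fps_nth (inverse R) (n - i))"
      using fps_inverse_nth_recurrence[OF R0] by simp
    also have "\<dots> = (\<Sum>i\<in>{a..b} \<inter> {..n}. ?c i * fps_nth (inverse R) (n - i))"
      using a less.prems by (intro sum.mono_neutral_right) auto
    also have "\<dots> = (\<Sum>i\<in>{a..b} \<inter> {..n}.
        ?c i * (\<Sum>t\<in>weighted_tuples a b (n - i). tuple_weight {a..b} ?c t))"
      using a False less.prems by (intro sum.cong refl arg_cong2[where f = times] less.IH) auto
    also have "\<dots> = (\<Sum>t\<in>weighted_tuples a b n. tuple_weight {a..b} ?c t)"
      using a False by (subst tuple_sum_recurrence[of a n]) auto
    finally show ?thesis .
  qed
qed

text \<open>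
  The inverse pair of Trudi's formula: the coefficients of \<open>H\<close> in terms of those of \<open>1 / H\<close>,
  with the sign \<open>(-1)^n\<close> distributed over the sum.
\<close>

lemma fps_nth_from_inverse:
  fixes H :: "rat fps"
  assumes a: "a \<ge> 1" and H0: "fps_nth H 0 = 1"
    and "\<And>i. 1 \<le> i \<Longrightarrow> i \<le> n \<Longrightarrow> i \<notin> {a..b} \<Longrightarrow> fps_nth (inverse H) i = 0"
  shows "(-1) ^ n * fps_nth H n =
    (\<Sum>t\<in>weighted_tuples a b n. multinomial {a..b} t * (-1) ^ (n - (\<Sum>i=a..b. t i)) *
       (\<Prod>i=a..b. fps_nth (inverse H) i ^ t i))"
proof -
  let ?r = "fps_nth (inverse H)"
  have sign: "(-1) ^ n * (\<Prod>i=a..b. (- ?r i) ^ t i) =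
      (-1) ^ (n - (\<Sum>i=a..b. t i)) * (\<Prod>i=a..b. ?r i ^ t i)"
    if t: "t \<in> weighted_tuples a b n" for t
  proof -
    let ?s = "\<Sum>i=a..b. t i"
    have "(\<Prod>i=a..b. (- ?r i) ^ t i) = (-1) ^ ?s * (\<Prod>i=a..b. ?r i ^ t i)"
      by (subst (1) power_minus) (simp add: prod.distrib power_sum)
    moreover have "(-1) ^ n * (-1) ^ ?s = ((-1) ^ (n - ?s) :: rat)"
      using weighted_tuples_sum_le[OF a t]
      by (metis minus_one_power_iff even_add even_diff_nat le_antisym power_add not_le_imp_less
          less_imp_le)
    ultimately show ?thesis by (simp add: mult.assoc[symmetric])
  qed
  have "fps_nth H n = fps_nth (inverse (inverse H)) n"
    using H0 by simp
  also have "\<dots> = (\<Sum>t\<in>weighted_tuples a b n. tuple_weight {a..b} (\<lambda>i. - ?r i) t)"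
    using assms by (intro fps_inverse_nth_trudi) auto
  finally have "(-1) ^ n * fps_nth H n = (\<Sum>t\<in>weighted_tuples a b n.
      multinomial {a..b} t * ((-1) ^ n * (\<Prod>i=a..b. (- ?r i) ^ t i)))"
    by (simp add: sum_distrib_left tuple_weight_def mult_ac)
  also have "\<dots> = (\<Sum>t\<in>weighted_tuples a b n. multinomial {a..b} t *
      ((-1) ^ (n - (\<Sum>i=a..b. t i)) * (\<Prod>i=a..b. ?r i ^ t i)))"
    by (intro sum.cong refl) (simp only: sign)
  finally show ?thesis by (simp only: mult.assoc)
qed

text \<open>
  The hypothesis on \<open>G\<close> says that \<open>G(x) = H(c x^k)\<close>, so that also \<open>1 / G\<close> arises from \<open>1 / H\<close> by
  this substitution.
\<close>

lemma fps_inverse_nth_monomial_substitution: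
  fixes G H :: "'a :: field fps"
  assumes k: "k \<ge> 1" and H0: "fps_nth H 0 \<noteq> 0"
    and G: "\<And>j. fps_nth G j = (if k dvd j then c ^ (j div k) * fps_nth H (j div k) else 0)"
  shows "fps_nth (inverse G) (k * i) = c ^ i * fps_nth (inverse H) i"
proof -
  let ?b = "fps_const c * fps_X ^ k"
  have comp: "fps_nth (Q oo ?b) j =
      (if k dvd j then c ^ (j div k) * fps_nth Q (j div k) else 0)" for Q j
  proof -
    have "fps_nth (Q oo ?b) j = (\<Sum>l=0..j. if j = k * l then c ^ l * fps_nth Q l else 0)"
      by (auto simp: fps_compose_nth power_mult_distrib power_mult[symmetric] fps_const_power
          intro!: sum.cong)
    also have "\<dots> = (\<Sum>l\<in>{l \<in> {0..j}. j = k * l}. c ^ l * fps_nth Q l)"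
      by (rule sum.inter_filter[symmetric]) simp
    also have "{l \<in> {0..j}. j = k * l} = (if k dvd j then {j div k} else {})"
      using k by (auto simp: dvd_def)
    finally show ?thesis by simp
  qed
  have "G = H oo ?b"
    by (rule fps_ext) (simp add: comp G)
  moreover have "inverse H oo ?b = inverse (H oo ?b)"
    using k H0 by (intro fps_inverse_compose) auto
  ultimately have "fps_nth (inverse G) (k * i) = fps_nth (inverse H oo ?b) (k * i)"
    by simp
  also have "\<dots> = c ^ i * fps_nth (inverse H) i"
    using k by (simp add: comp)
  finally show ?thesis .
qed

section \<open>The four families\<close>

text \<open>
  The common generating function of the four families, with \<open>S\<close> the set of retained degrees. The
  sign is built in because \<open>(-1)^n\<close> is part of \<open>\<xi>\<^sub>n\<close> for all families but Cauchy's, whose generating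
  function already contains it.
\<close>

definition signed_alpha_series :: "family \<Rightarrow> nat \<Rightarrow> nat set \<Rightarrow> rat fps" where
  "signed_alpha_series F N S = Abs_fps (\<lambda>i. if i \<in> S then (-1) ^ i * alpha F N i else 0)"

lemma alpha_0: "admissible F N \<Longrightarrow> alpha F N 0 = 1"
  by (cases F) auto

lemma pochhammer_eq_fact_quotient:
  "pochhammer (of_nat M + 1) k = (fact (M + k) / fact M :: 'a :: field_char_0)"
  using pochhammer_product'[of "1 :: 'a" M k]
  by (simp add: pochhammer_fact[symmetric] add.commute field_simps)

lemma alpha_pochhammer:
  "alpha Bernoulli N j = 1 / pochhammer (of_nat N + 1) j"
  "alpha Euler N j = 1 / pochhammer (2 * of_nat N + 1) (2 * j)"
  "alpha Euler2 N j = 1 / pochhammer (2 * of_nat N + 2) (2 * j)"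
  using pochhammer_eq_fact_quotient[of N j, where ?'a = rat]
    pochhammer_eq_fact_quotient[of "2 * N" "2 * j", where ?'a = rat]
    pochhammer_eq_fact_quotient[of "2 * N + 1" "2 * j", where ?'a = rat]
  by (simp_all add: add_ac)

lemma minus_fps_X_power_nth:
  "fps_nth ((- fps_X) ^ i :: 'a :: comm_ring_1 fps) j = (if j = i then (-1) ^ i else 0)"
  by (cases "even i") (auto simp: minus_one_power_iff)

lemma fps_of_nat_mult_nth:
  "fps_nth (of_nat N * f :: 'a :: comm_ring_1 fps) j = of_nat N * fps_nth f j"
  by (simp add: fps_of_nat[symmetric])

lemma sum_even_powers_nth:
  "fps_nth (\<Sum>i=0..m. fps_const (f i) * fps_X ^ (2 * i) :: 'a :: comm_ring_1 fps) j =
    (if 2 dvd j \<and> j div 2 \<le> m then f (j div 2) else 0)"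
proof -
  have "fps_nth (\<Sum>i=0..m. fps_const (f i) * fps_X ^ (2 * i)) j =
      (\<Sum>i=0..m. if j = 2 * i then f i else 0)"
    by (auto simp: fps_sum_nth intro!: sum.cong)
  also have "\<dots> = (\<Sum>i\<in>{i \<in> {0..m}. j = 2 * i}. f i)"
    by (rule sum.inter_filter[symmetric]) simp
  also have "{i \<in> {0..m}. j = 2 * i} = (if 2 dvd j \<and> j div 2 \<le> m then {j div 2} else {})"
    by auto
  finally show ?thesis by simp
qed

text \<open>
  In the next two lemmas, the series inverted in the definition of the family is \<open>H(-x)\<close>, \<open>H(x)\<close> or
  \<open>H(-x\<^sup>2)\<close>, where \<open>H\<close> is the signed series. The factorial in \<open>\<xi>\<^sub>i\<close> cancels that of the exponential
  generating function, and its sign cancels the power of \<open>-1\<close> produced by the substitution.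
\<close>

lemma A_le_over_xi:
  assumes adm: "admissible F N"
  shows "A_le F N m i / xi F i = fps_nth (inverse (signed_alpha_series F N {..m})) i"
proof -
  let ?H = "signed_alpha_series F N {..m}"
  have H0: "fps_nth ?H 0 \<noteq> 0"
    using alpha_0[OF adm] by (simp add: signed_alpha_series_def)
  note subst = fps_inverse_nth_monomial_substitution[OF _ H0]
  show ?thesis
  proof (cases F)
    case Bernoulli
    have "fps_nth (\<Sum>i=0..m. fps_const (1 / pochhammer (of_nat N + 1) i) * fps_X ^ i) j =
        (if 1 dvd j then (-1) ^ (j div 1) * fps_nth ?H (j div 1) else 0)" for j
      using Bernoulli
      by (auto simp: signed_alpha_series_def fps_sum_nth if_distrib alpha_pochhammer
          simp del: alpha.simps cong: if_cong)
    from subst[OF _ this, of i] show ?thesis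
      using Bernoulli by (simp add: bernoulli_le_def egf_coeff_def)
  next
    case Cauchy
    have "fps_nth (of_nat N * (\<Sum>i=0..m. fps_const (1 / (of_nat N + of_nat i)) * (- fps_X) ^ i)) j =
        (if 1 dvd j then 1 ^ (j div 1) * fps_nth ?H (j div 1) else 0)" for j
      using Cauchy
      by (auto simp: signed_alpha_series_def fps_of_nat_mult_nth fps_sum_nth minus_fps_X_power_nth
          if_distrib cong: if_cong)
    from subst[OF _ this, of i] show ?thesis
      using Cauchy by (simp add: cauchy_le_def egf_coeff_def)
  next
    case Euler
    have "fps_nth (\<Sum>i=0..m. fps_const (1 / pochhammer (2 * of_nat N + 1) (2 * i)) *
          fps_X ^ (2 * i)) j =
        (if 2 dvd j then (-1) ^ (j div 2) * fps_nth ?H (j div 2) else 0)" for j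
      unfolding sum_even_powers_nth using Euler
      by (auto simp: signed_alpha_series_def alpha_pochhammer simp del: alpha.simps)
    from subst[OF _ this, of i] show ?thesis
      using Euler by (simp add: euler_le_def egf_coeff_def)
  next
    case Euler2
    have "fps_nth (\<Sum>i=0..m. fps_const (1 / pochhammer (2 * of_nat N + 2) (2 * i)) *
          fps_X ^ (2 * i)) j =
        (if 2 dvd j then (-1) ^ (j div 2) * fps_nth ?H (j div 2) else 0)" for j
      unfolding sum_even_powers_nth using Euler2
      by (auto simp: signed_alpha_series_def alpha_pochhammer simp del: alpha.simps)
    from subst[OF _ this, of i] show ?thesis
      using Euler2 by (simp add: euler2_le_def egf_coeff_def)
  qed
qed

lemma A_ge_over_xi:
  assumes adm: "admissible F N" and m: "m \<ge> 1"
  shows "A_ge F N m i / xi F i = fps_nth (inverse (signed_alpha_series F N (insert 0 {m..}))) i"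
proof -
  let ?H = "signed_alpha_series F N (insert 0 {m..})"
  have H0: "fps_nth ?H 0 \<noteq> 0"
    using alpha_0[OF adm] by (simp add: signed_alpha_series_def)
  note subst = fps_inverse_nth_monomial_substitution[OF _ H0]
  show ?thesis
  proof (cases F)
    case Bernoulli
    have "fps_nth (1 + Abs_fps (\<lambda>k. if m \<le> k then 1 / pochhammer (of_nat N + 1) k else 0)) j =
        (if 1 dvd j then (-1) ^ (j div 1) * fps_nth ?H (j div 1) else 0)" for j
      using Bernoulli m
      by (auto simp: signed_alpha_series_def alpha_pochhammer simp del: alpha.simps)
    from subst[OF _ this, of i] show ?thesis
      using Bernoulli by (simp add: bernoulli_ge_def egf_coeff_def)
  next
    case Cauchy
    have "fps_nth (1 + of_nat N * Abs_fps (\<lambda>k. if m \<le> k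
          then (-1) ^ k / (of_nat N + of_nat k) else 0)) j =
        (if 1 dvd j then 1 ^ (j div 1) * fps_nth ?H (j div 1) else 0)" for j
      using Cauchy m adm
      by (auto simp: signed_alpha_series_def fps_of_nat_mult_nth)
    from subst[OF _ this, of i] show ?thesis
      using Cauchy by (simp add: cauchy_ge_def egf_coeff_def)
  next
    case Euler
    have "fps_nth (1 + Abs_fps (\<lambda>k. if even k \<and> 2 * m \<le> k
          then 1 / pochhammer (2 * of_nat N + 1) k else 0)) j =
        (if 2 dvd j then (-1) ^ (j div 2) * fps_nth ?H (j div 2) else 0)" for j
      using Euler m
      by (auto simp: signed_alpha_series_def alpha_pochhammer simp del: alpha.simps elim!: evenE)
    from subst[OF _ this, of i] show ?thesis
      using Euler by (simp add: euler_ge_def egf_coeff_def)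
  next
    case Euler2
    have "fps_nth (1 + Abs_fps (\<lambda>k. if even k \<and> 2 * m \<le> k
          then 1 / pochhammer (2 * of_nat N + 2) k else 0)) j =
        (if 2 dvd j then (-1) ^ (j div 2) * fps_nth ?H (j div 2) else 0)" for j
      using Euler2 m
      by (auto simp: signed_alpha_series_def alpha_pochhammer simp del: alpha.simps elim!: evenE)
    from subst[OF _ this, of i] show ?thesis
      using Euler2 by (simp add: euler2_ge_def egf_coeff_def)
  qed
qed

theorem proposition10:
  fixes F :: family and N m n :: nat
  assumes "admissible F N" and "m \<ge> 1" and "n \<ge> 1"
  shows "(n \<le> m \<longrightarrow>
            alpha F N n =
              (\<Sum>t\<in>weighted_tuples 1 m n.
                 multinomial {1..m} t * (-1) ^ (n - (\<Sum>i=1..m. t i)) *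
                 (\<Prod>i=1..m. (A_le F N m i / xi F i) ^ t i))) \<and>
         (n \<ge> m \<longrightarrow>
            alpha F N n =
              (\<Sum>t\<in>weighted_tuples m n n.
                 multinomial {m..n} t * (-1) ^ (n - (\<Sum>i=m..n. t i)) *
                 (\<Prod>i=m..n. (A_ge F N m i / xi F i) ^ t i)))"
proof (intro conjI impI)
  assume "n \<le> m"
  let ?H = "signed_alpha_series F N {..m}"
  have "alpha F N n = (-1) ^ n * fps_nth ?H n"
    using \<open>n \<le> m\<close> by (simp add: signed_alpha_series_def mult.assoc[symmetric]
        power_mult_distrib[symmetric])
  also have "\<dots> = (\<Sum>t\<in>weighted_tuples 1 m n.
      multinomial {1..m} t * (-1) ^ (n - (\<Sum>i=1..m. t i)) * (\<Prod>i=1..m. fps_nth (inverse ?H) i ^ t i))"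
    using \<open>n \<le> m\<close> alpha_0[OF assms(1)]
    by (intro fps_nth_from_inverse) (auto simp: signed_alpha_series_def)
  finally show "alpha F N n = (\<Sum>t\<in>weighted_tuples 1 m n.
      multinomial {1..m} t * (-1) ^ (n - (\<Sum>i=1..m. t i)) *
      (\<Prod>i=1..m. (A_le F N m i / xi F i) ^ t i))"
    by (simp only: A_le_over_xi[OF assms(1)])
next
  assume "m \<le> n"
  let ?H = "signed_alpha_series F N (insert 0 {m..})"
  have H0: "fps_nth ?H 0 = 1"
    using alpha_0[OF assms(1)] by (simp add: signed_alpha_series_def)
  have gap: "fps_nth (inverse ?H) i = 0" if "1 \<le> i" "i < m" for i
    using that unfolding fps_inverse_nth_recurrence[OF H0 that(1)]
    by (intro sum.neutral) (auto simp: signed_alpha_series_def)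
  have "alpha F N n = (-1) ^ n * fps_nth ?H n"
    using \<open>m \<le> n\<close> by (simp add: signed_alpha_series_def mult.assoc[symmetric]
        power_mult_distrib[symmetric])
  also have "\<dots> = (\<Sum>t\<in>weighted_tuples m n n.
      multinomial {m..n} t * (-1) ^ (n - (\<Sum>i=m..n. t i)) * (\<Prod>i=m..n. fps_nth (inverse ?H) i ^ t i))"
    using assms(2) H0 gap by (intro fps_nth_from_inverse) auto
  finally show "alpha F N n = (\<Sum>t\<in>weighted_tuples m n n.
      multinomial {m..n} t * (-1) ^ (n - (\<Sum>i=m..n. t i)) *
      (\<Prod>i=m..n. (A_ge F N m i / xi F i) ^ t i))"
    by (simp only: A_ge_over_xi[OF assms(1,2)])
qed

end
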